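(* Let $n_1\ge n_2\ge 1$, $D\in\mathbb{R}^{n_1\times n_2}$, $\lambda>0$, $\mu>0$, and let $\Omega_{\rm obs}\subseteq\{(j,k): j\in\{1,\dots,n_1\},\,k\in\{1,\dots,n_2\}\}$ be a nonempty set of observed indices. The problem $$\min_{L,S}\ \|L\|_*+\lambda\|S\|_1+\mu\sqrt{\sum_{(i,j)\in\Omega_{\rm obs}}(L_{ij}+S_{ij}-D_{ij})^2}\qquad (\mathrm{P})$$ is equivalent to the distributionally robust formulation of a squared loss problem $$(\mathrm{R})\qquad \inf_{L,S}\ \sup_{\xi_{jk},\zeta_{jk},\,(j,k)\in\Omega_{\rm obs}}\ \frac{1}{|\Omega_{\rm obs}|}\sum_{(j,k)\in\Omega_{\rm obs}}\mathrm{E}\Big[\big((D-L-S)_{jk}+\langle\xi_{jk},L\rangle+\langle\zeta_{jk},S\rangle\big)^2\Big]$$ $$\text{s.t.}\quad \sum_{(j,k)\in\Omega_{\rm obs}}\mathrm{E}\Big[\max\big\{\|\xi_{jk}\|^2,\ \|\zeta_{jk}\|_\infty^2/\lambda^2\big\}\Big]\le\frac{1}{\mu^2},$$ where $L,S$ range over $\mathbb{R}^{n_1\times n_2}$ and the $\xi_{jk},\zeta_{jk}$, $(j,k)\in\Omega_{\rm obs}$, range over random matrices in $\mathbb{R}^{n_1\times n_2}$. The equivalence is in the following sense: the optimal value of $(\mathrm{R})$ equals $\frac{1}{\mu^2|\Omega_{\rm obs}|}$ times the square of the optimal value of $(\mathrm{P})$.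
   Context: For a matrix $X$: $\|X\|$ is the spectral norm, $\|X\|_*$ the nuclear norm, $\|X\|_1=\sum_{i,j}|X_{ij}|$, $\|X\|_\infty=\max_{i,j}|X_{ij}|$, and $\langle X,Y\rangle=\mathrm{Tr}(X^TY)$. In $(\mathrm{R})$ the outer infimum is over $(L,S)$, and for each fixed $(L,S)$ the inner supremum is over all families of random matrices $\{(\xi_{jk},\zeta_{jk})\}_{(j,k)\in\Omega_{\rm obs}}$ (with arbitrary distributions) satisfying the stated expectation constraint. In the underlying observation model $\Omega_{\rm obs}$ is obtained by random sampling of indices; here it is treated as a given (realized) index set. *)

theory Defs
  imports "HOL-Analysis.Analysis" "HOL-Probability.Probability"
begin

text \<open>
  An $n_1 \times n_2$ matrix is an element of \<open>real^'n2^'n1\<close>: \<open>X $ j $ k\<close> is the entry in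
  row \<open>j :: 'n1\<close> and column \<open>k :: 'n2\<close>.
\<close>

definition spectral_norm :: "real^'n2^'n1 \<Rightarrow> real" where
  "spectral_norm X = onorm (\<lambda>v. X *v v)"

text \<open>
  Singular values are the square roots of the eigenvalues of $X^T X$. The multiplicity of such an
  eigenvalue is the dimension of its eigenspace; as $X^T X$ is symmetric, this is also its
  algebraic multiplicity.
\<close>

definition singular_space :: "real^'n2^'n1 \<Rightarrow> real \<Rightarrow> (real^'n2) set" where
  "singular_space X s = {v. (transpose X ** X) *v v = s\<^sup>2 *\<^sub>R v}"

definition singular_values :: "real^'n2^'n1 \<Rightarrow> real set" where
  "singular_values X = {s. 0 \<le> s \<and> (\<exists>v. v \<noteq> 0 \<and> v \<in> singular_space X s)}"

definition nuclear_norm :: "real^'n2^'n1 \<Rightarrow> real" where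
  "nuclear_norm X = (\<Sum>s\<in>singular_values X. real (dim (singular_space X s)) * s)"

definition entry_l1_norm :: "real^'n2^'n1 \<Rightarrow> real" where
  "entry_l1_norm X = (\<Sum>j\<in>UNIV. \<Sum>k\<in>UNIV. \<bar>X $ j $ k\<bar>)"

definition entry_max_norm :: "real^'n2^'n1 \<Rightarrow> real" where
  "entry_max_norm X = Max (range (\<lambda>(j, k). \<bar>X $ j $ k\<bar>))"

definition mat_inner :: "real^'n2^'n1 \<Rightarrow> real^'n2^'n1 \<Rightarrow> real" where
  "mat_inner X Y = trace (transpose X ** Y)"

definition P_objective ::
  "real^'n2^'n1 \<Rightarrow> ('n1 \<times> 'n2) set \<Rightarrow> real \<Rightarrow> real \<Rightarrow> real^'n2^'n1 \<Rightarrow> real^'n2^'n1 \<Rightarrow> real" where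
  "P_objective D \<Omega> lam \<mu> L S =
     nuclear_norm L + lam * entry_l1_norm S
       + \<mu> * sqrt (\<Sum>(j, k)\<in>\<Omega>. (L $ j $ k + S $ j $ k - D $ j $ k)\<^sup>2)"

definition P_value :: "real^'n2^'n1 \<Rightarrow> ('n1 \<times> 'n2) set \<Rightarrow> real \<Rightarrow> real \<Rightarrow> real" where
  "P_value D \<Omega> lam \<mu> = (INF (L, S)\<in>UNIV. P_objective D \<Omega> lam \<mu> L S)"

text \<open>
  Expectations of nonnegative quantities are taken in \<open>ennreal\<close>, so a divergent expectation
  is \<open>\<infinity>\<close> (and violates the constraint) rather than the default value 0 of the Bochner integral.
  A family consists of a probability space together with random matrices indexed by \<open>\<Omega>\<close> on it;
  values of \<open>\<xi>\<close>, \<open>\<zeta>\<close> at indices outside \<open>\<Omega>\<close> are irrelevant.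
\<close>

definition R_feasible ::
  "('n1 \<times> 'n2) set \<Rightarrow> real \<Rightarrow> real \<Rightarrow>
    ('w measure \<times> ('n1 \<times> 'n2 \<Rightarrow> 'w \<Rightarrow> real^'n2^'n1) \<times> ('n1 \<times> 'n2 \<Rightarrow> 'w \<Rightarrow> real^'n2^'n1)) set" where
  "R_feasible \<Omega> lam \<mu> = {(M, \<xi>, \<zeta>).
     prob_space M \<and>
     (\<forall>p\<in>\<Omega>. \<xi> p \<in> borel_measurable M \<and> \<zeta> p \<in> borel_measurable M) \<and>
     (\<Sum>p\<in>\<Omega>. \<integral>\<^sup>+ \<omega>. ennreal (max ((spectral_norm (\<xi> p \<omega>))\<^sup>2)
                                ((entry_max_norm (\<zeta> p \<omega>))\<^sup>2 / lam\<^sup>2)) \<partial>M)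
       \<le> ennreal (1 / \<mu>\<^sup>2)}"

definition R_objective ::
  "real^'n2^'n1 \<Rightarrow> ('n1 \<times> 'n2) set \<Rightarrow> real^'n2^'n1 \<Rightarrow> real^'n2^'n1 \<Rightarrow> 'w measure \<Rightarrow>
    ('n1 \<times> 'n2 \<Rightarrow> 'w \<Rightarrow> real^'n2^'n1) \<Rightarrow> ('n1 \<times> 'n2 \<Rightarrow> 'w \<Rightarrow> real^'n2^'n1) \<Rightarrow> ennreal" where
  "R_objective D \<Omega> L S M \<xi> \<zeta> =
     ennreal (1 / real (card \<Omega>)) *
     (\<Sum>(j, k)\<in>\<Omega>. \<integral>\<^sup>+ \<omega>. ennreal (((D - L - S) $ j $ k
        + mat_inner (\<xi> (j, k) \<omega>) L + mat_inner (\<zeta> (j, k) \<omega>) S)\<^sup>2) \<partial>M)"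

text \<open>
  The type argument is the type of outcomes. It is arbitrary; families with arbitrary (joint) laws
  all occur over, for instance, the type \<open>'n1 \<times> 'n2 \<Rightarrow> (real^'n2^'n1) \<times> (real^'n2^'n1)\<close> of families
  of pairs of matrices.
\<close>

definition R_value ::
  "'w itself \<Rightarrow> real^'n2^'n1 \<Rightarrow> ('n1 \<times> 'n2) set \<Rightarrow> real \<Rightarrow> real \<Rightarrow> ennreal" where
  "R_value (_ :: 'w itself) D \<Omega> lam \<mu> =
     (INF (L, S)\<in>UNIV. SUP (M :: 'w measure, \<xi>, \<zeta>)\<in>R_feasible \<Omega> lam \<mu>.
        R_objective D \<Omega> L S M \<xi> \<zeta>)"

end

theory Submission
  imports Defs
begin

text \<open>
  Fix \<open>(L, S)\<close> and write \<open>r\<close> for the residual \<open>D - L - S\<close> on \<open>\<Omega>\<close>, \<open>\<rho>\<close> for its Euclidean norm and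
  \<open>A = \<parallel>L\<parallel>\<^sub>* + lam * \<parallel>S\<parallel>\<^sub>1\<close>. The point is that the inner supremum is explicit: it equals
  \<open>(\<rho> + A / \<mu>)\<^sup>2 / |\<Omega>|\<close>, which is \<open>1 / (\<mu>\<^sup>2 |\<Omega>|)\<close> times the square of the objective \<open>A + \<mu> \<rho>\<close>
  of the deterministic problem (\<open>worst_case_value\<close>).

  No family does better. The spectral and nuclear norms are dual to each other, and so are the
  entrywise maximum and \<open>\<ell>\<^sub>1\<close> norms; hence \<open>t = \<langle>\<xi>, L\<rangle> + \<langle>\<zeta>, S\<rangle>\<close> is at most
  \<open>A * max \<parallel>\<xi>\<parallel> (\<parallel>\<zeta>\<parallel>\<^sub>\<infinity> / lam)\<close> in absolute value (\<open>perturbation_bound\<close>). The constraint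
  then bounds the \<open>L\<^sup>2\<close> norm of \<open>t\<close> on \<open>\<Omega>\<close> times the probability space by \<open>A / \<mu>\<close>, and
  Minkowski's inequality bounds that of \<open>r + t\<close> by \<open>\<rho> + A / \<mu>\<close>
  (\<open>sum_nn_integral_square_add_le\<close>).

  The bound is attained, already without randomness (\<open>worst_case_attained\<close>): at each index take a
  multiple \<open>c p\<close> of the matrices for which both duality bounds are equalities, and choose the vector
  \<open>c\<close> of length \<open>1 / \<mu>\<close> parallel to \<open>r\<close>, which is equality in Minkowski.

  Since \<open>y \<mapsto> y\<^sup>2\<close> is continuous and increasing for \<open>y \<ge> 0\<close>, the outer infimum commutes with squaring
  (\<open>INF_ennreal_mult_power2\<close>).

  The duality of spectral and nuclear norm rests on an orthonormal basis of right singular vectors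
  (\<open>singular_basis_exists\<close>). In such a basis \<open>\<langle>X, L\<rangle> = \<Sum> (X b) \<bullet> (L b)\<close>, the vectors \<open>L b\<close> are
  pairwise orthogonal, and the nuclear norm is the sum of their lengths.
\<close>

section \<open>An orthonormal basis of right singular vectors\<close>

lemma gram_inner:
  fixes X :: "real^'n2^'n1"
  shows "((transpose X ** X) *v v) \<bullet> w = (X *v v) \<bullet> (X *v w)"
  by (simp add: matrix_vector_mul_assoc [symmetric] transpose_matrix_vector dot_lmul_matrix)

text \<open>First-order optimality in elementary form: near \<open>t = 0\<close> the linear term would decide the sign.\<close>

lemma linear_coeff_zero_if_quadratic_nonneg:
  fixes a b :: real
  assumes "\<And>t. 0 \<le> 2 * t * a + t\<^sup>2 * b"
  shows "a = 0"
proof (rule ccontr)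
  assume "a \<noteq> 0"
  define c where "c = \<bar>b\<bar> + 1"
  have c: "c > 0" "b < c" by (auto simp: c_def)
  \<comment> \<open>a step of \<open>a / c\<close> against the slope, short enough for the linear term to outweigh the quadratic one\<close>
  have "0 \<le> 2 * (- a / c) * a + (- a / c)\<^sup>2 * b" by (rule assms)
  also have "\<dots> = (a\<^sup>2 / c\<^sup>2) * (b - 2 * c)"
    using c by (simp add: field_simps power2_eq_square)
  also have "\<dots> < 0"
    using c \<open>a \<noteq> 0\<close> by (intro mult_pos_neg) auto
  finally show False by simp
qed

text \<open>
  A unit vector of \<open>V\<close> that \<open>X\<close> stretches most is an eigenvector of \<open>X\<^sup>T X\<close>: optimality makes
  \<open>s\<^sup>2 v - X\<^sup>T X v\<close> orthogonal to \<open>V\<close>, and invariance puts this vector into \<open>V\<close>, so it vanishes.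
\<close>

lemma singular_vector_in_invariant_subspace:
  fixes X :: "real^'n2^'n1"
  assumes V: "subspace V" and inv: "\<And>v. v \<in> V \<Longrightarrow> (transpose X ** X) *v v \<in> V"
    and nz: "u \<in> V" "u \<noteq> 0"
  obtains v s where "v \<in> V" "norm v = 1" "0 \<le> s" "v \<in> singular_space X s"
proof -
  let ?K = "V \<inter> sphere 0 1"
  have "compact ?K"
    by (intro closed_Int_compact closed_subspace V compact_sphere)
  moreover have "u /\<^sub>R norm u \<in> ?K"
    using V nz by (auto simp: subspace_scale)
  moreover have "continuous_on ?K (\<lambda>v. norm (X *v v))"
    by (intro continuous_intros linear_continuous_on linear_conv_bounded_linear[THEN iffD1]
        matrix_vector_mul_linear)
  ultimately obtain v where v: "v \<in> ?K" and max: "\<And>w. w \<in> ?K \<Longrightarrow> norm (X *v w) \<le> norm (X *v v)"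
    using continuous_attains_sup[of ?K] by blast
  define s where "s = norm (X *v v)"
  have nv: "norm v = 1" and vV: "v \<in> V" using v by auto
  have bound: "(norm (X *v w))\<^sup>2 \<le> s\<^sup>2 * (norm w)\<^sup>2" if "w \<in> V" for w
  proof (cases "w = 0")
    case False
    have "norm (X *v (w /\<^sub>R norm w)) \<le> s"
      unfolding s_def using that False V by (intro max) (auto simp: subspace_scale)
    then have "norm (X *v w) \<le> s * norm w"
      using False by (simp add: matrix_vector_mult_scaleR field_simps)
    then show ?thesis
      by (metis norm_ge_zero power_mono power_mult_distrib)
  qed simp
  let ?r = "s\<^sup>2 *\<^sub>R v - (transpose X ** X) *v v"
  \<comment> \<open>the quadratic in \<open>t\<close> is the slack of \<open>bound\<close> at \<open>v + t w\<close>, which is zero at \<open>t = 0\<close>\<close>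
  have "?r \<bullet> w = 0" if w: "w \<in> V" for w
  proof (rule linear_coeff_zero_if_quadratic_nonneg)
    fix t :: real
    have "v + t *\<^sub>R w \<in> V" using V vV w by (simp add: subspace_add subspace_scale)
    from bound[OF this]
    have "(X *v v + t *\<^sub>R (X *v w)) \<bullet> (X *v v + t *\<^sub>R (X *v w))
        \<le> s\<^sup>2 * ((v + t *\<^sub>R w) \<bullet> (v + t *\<^sub>R w))"
      by (simp add: dot_square_norm matrix_vector_right_distrib matrix_vector_mult_scaleR)
    moreover have "(X *v v) \<bullet> (X *v v) = s\<^sup>2" "v \<bullet> v = 1"
      by (simp_all add: dot_square_norm s_def nv)
    ultimately show "0 \<le> 2 * t * (?r \<bullet> w) + t\<^sup>2 * (s\<^sup>2 * (w \<bullet> w) - (X *v w) \<bullet> (X *v w))"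
      by (simp add: inner_add_left inner_add_right inner_diff_left gram_inner
          inner_commute[of w v] inner_commute[of "X *v w" "X *v v"] algebra_simps power2_eq_square)
  qed
  moreover have "?r \<in> V"
    using V vV inv by (simp add: subspace_diff subspace_scale)
  ultimately have "?r \<bullet> ?r = 0" by blast
  then have "v \<in> singular_space X s"
    by (simp add: singular_space_def)
  then show thesis
    using that[of v s] nv vV by (simp add: s_def)
qed

lemma subspace_singular_space: "subspace (singular_space X s)"
  by (auto simp: singular_space_def subspace_def matrix_vector_right_distrib
      matrix_vector_mult_scaleR scaleR_add_right)

lemma singular_space_inner:
  assumes "v \<in> singular_space X s"
  shows "(X *v v) \<bullet> (X *v w) = s\<^sup>2 * (v \<bullet> w)"
  using assms by (simp add: gram_inner [symmetric] singular_space_def)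

lemma singular_spaces_orthogonal:
  assumes "v \<in> singular_space X s" "w \<in> singular_space X t" "0 \<le> s" "0 \<le> t" "s \<noteq> t"
  shows "orthogonal v w"
proof -
  have "s\<^sup>2 * (v \<bullet> w) = t\<^sup>2 * (v \<bullet> w)"
    using singular_space_inner[OF assms(1), of w] singular_space_inner[OF assms(2), of v]
    by (simp add: inner_commute)
  moreover have "s\<^sup>2 \<noteq> t\<^sup>2" using assms by simp
  ultimately show ?thesis by (simp add: orthogonal_def)
qed

text \<open>
  The orthogonal complement of all eigenvectors of \<open>X\<^sup>T X\<close> is invariant under this symmetric matrix.
  Were it nonzero, it would contain an eigenvector, orthogonal to itself.
\<close>

lemma singular_spaces_span:
  fixes X :: "real^'n2^'n1"
  shows "span (\<Union>s\<in>{0..}. singular_space X s) = UNIV"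
proof -
  let ?E = "\<Union>s\<in>{0..}. singular_space X s"
  let ?V = "{v. \<forall>w\<in>?E. orthogonal w v}"
  have "?V \<subseteq> {0}"
  proof (rule subsetI, rule ccontr)
    fix u assume u: "u \<in> ?V" "u \<notin> {0}"
    have "(transpose X ** X) *v v \<in> ?V" if v: "v \<in> ?V" for v
    proof (clarsimp simp: orthogonal_def)
      fix s w assume "0 \<le> s" and w: "w \<in> singular_space X s"
      with v have "w \<bullet> v = 0" by (auto simp: orthogonal_def)
      then show "w \<bullet> ((transpose X ** X) *v v) = 0"
        using singular_space_inner[OF w, of v]
        by (simp add: inner_commute[of w "_ *v v"] gram_inner inner_commute[of "X *v v"])
    qed
    with u subspace_orthogonal_to_vectors[of ?E]
    obtain v s where v: "v \<in> ?V" "norm v = 1" "0 \<le> s" "v \<in> singular_space X s"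
      using singular_vector_in_invariant_subspace[of ?V X u] by (metis (no_types, lifting) singletonI)
    then have "orthogonal v v" by blast
    with v(2) show False by (auto simp: orthogonal_self)
  qed
  moreover have "x \<in> span ?E" if "?V \<subseteq> {0}" for x
  proof -
    obtain y z where yz: "y \<in> span ?E" "\<And>w. w \<in> span ?E \<Longrightarrow> orthogonal z w" "x = y + z"
      using orthogonal_subspace_decomp_exists by blast
    have "orthogonal w z" if "w \<in> ?E" for w
      using yz(2)[OF span_base[OF that]] by (simp add: orthogonal_commute)
    then have "z \<in> ?V" by blast
    with \<open>?V \<subseteq> {0}\<close> have "z = 0" by blast
    with yz show ?thesis by simp
  qed
  ultimately show ?thesis by blast
qed

text \<open>
  Glue orthonormal bases of the eigenspaces. The value \<open>\<sigma> b\<close> attached to a basis vector is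
  \<open>\<parallel>X b\<parallel>\<close>; grouping the basis by \<open>\<sigma>\<close> recovers the eigenspaces, and the group sizes are the
  multiplicities by which the nuclear norm weights the singular values.
\<close>

lemma singular_basis_exists:
  fixes X :: "real^'n2^'n1"
  obtains B \<sigma> where "finite B" "pairwise orthogonal B" "\<And>b. b \<in> B \<Longrightarrow> norm b = 1"
    "span B = UNIV" "\<And>b. b \<in> B \<Longrightarrow> 0 \<le> \<sigma> b" "\<And>b. b \<in> B \<Longrightarrow> b \<in> singular_space X (\<sigma> b)"
    "nuclear_norm X = (\<Sum>b\<in>B. \<sigma> b)"
proof -
  have "\<exists>C. C \<subseteq> singular_space X s \<and> pairwise orthogonal C \<and> (\<forall>b\<in>C. norm b = 1) \<and>
      independent C \<and> card C = dim (singular_space X s) \<and> span C = singular_space X s" for s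
    using orthonormal_basis_subspace[OF subspace_singular_space[of X s]] by metis
  then obtain C where C: "\<And>s. C s \<subseteq> singular_space X s" "\<And>s. pairwise orthogonal (C s)"
      "\<And>s b. b \<in> C s \<Longrightarrow> norm b = 1" "\<And>s. card (C s) = dim (singular_space X s)"
      "\<And>s. span (C s) = singular_space X s"
    by metis
  define B where "B = (\<Union>s\<in>{0..}. C s)"
  define \<sigma> where "\<sigma> b = norm (X *v b)" for b
  have \<sigma>: "\<sigma> b = s" if "b \<in> C s" "0 \<le> s" for b s
  proof -
    have "(norm (X *v b))\<^sup>2 = s\<^sup>2"
      using singular_space_inner[of b X s b] that C by (auto simp: dot_square_norm)
    then show ?thesis using that by (simp add: \<sigma>_def)
  qed
  have \<sigma>0: "0 \<le> \<sigma> b" for b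
    by (simp add: \<sigma>_def)
  have B_iff: "b \<in> B \<longleftrightarrow> b \<in> C (\<sigma> b)" for b
  proof
    assume "b \<in> B"
    then obtain s where s: "0 \<le> s" "b \<in> C s" by (auto simp: B_def)
    with \<sigma>[OF s(2,1)] show "b \<in> C (\<sigma> b)" by simp
  qed (use \<sigma>0 in \<open>auto simp: B_def\<close>)
  have orth: "pairwise orthogonal B"
  proof (rule pairwiseI)
    fix b c assume bc: "b \<in> B" "c \<in> B" "b \<noteq> c"
    show "orthogonal b c"
    proof (cases "\<sigma> b = \<sigma> c")
      case True
      with bc C(2)[of "\<sigma> b"] show ?thesis by (auto simp: B_iff pairwise_def)
    next
      case False
      have "b \<in> singular_space X (\<sigma> b)" "c \<in> singular_space X (\<sigma> c)"
        using bc C(1) B_iff by auto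
      then show ?thesis
        using \<sigma>0 \<sigma>0 False by (rule singular_spaces_orthogonal)
    qed
  qed
  have nB: "norm b = 1" if "b \<in> B" for b
    using that C(3) by (simp add: B_iff)
  have "0 \<notin> B" using nB[of 0] by auto
  with orth have fin: "finite B"
    using pairwise_orthogonal_imp_finite by blast
  have "(\<Union>s\<in>{0..}. singular_space X s) \<subseteq> span B"
  proof (rule UN_least)
    fix s :: real assume "s \<in> {0..}"
    then have "span (C s) \<subseteq> span B" by (intro span_mono) (auto simp: B_def)
    then show "singular_space X s \<subseteq> span B" by (simp add: C(5))
  qed
  then have "span (\<Union>s\<in>{0..}. singular_space X s) \<subseteq> span B"
    by (rule span_minimal) (rule subspace_span)
  then have sp: "span B = UNIV"
    by (simp add: singular_spaces_span top.extremum_unique)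
  have img: "\<sigma> ` B = singular_values X"
  proof (intro equalityI subsetI)
    fix s assume "s \<in> \<sigma> ` B"
    then obtain b where b: "b \<in> B" "s = \<sigma> b" by blast
    then have "b \<noteq> 0" "b \<in> singular_space X s" using \<open>0 \<notin> B\<close> C(1) B_iff by auto
    then show "s \<in> singular_values X" using b \<sigma>0 by (auto simp: singular_values_def)
  next
    fix s assume "s \<in> singular_values X"
    then obtain v where v: "0 \<le> s" "v \<noteq> 0" "v \<in> span (C s)"
      by (auto simp: singular_values_def C(5))
    then obtain b where "b \<in> C s" by (cases "C s = {}") auto
    with \<sigma>[OF this v(1)] show "s \<in> \<sigma> ` B" by (auto simp: B_iff intro!: image_eqI[of _ _ b])
  qed
  have fib: "{b \<in> B. \<sigma> b = s} = C s" if "s \<in> \<sigma> ` B" for s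
  proof -
    from that \<sigma>0 have "0 \<le> s" by auto
    with \<sigma>[of _ s] show ?thesis by (auto simp: B_iff)
  qed
  have "(\<Sum>b\<in>B. \<sigma> b) = (\<Sum>s\<in>\<sigma> ` B. \<Sum>b\<in>{b \<in> B. \<sigma> b = s}. \<sigma> b)"
    by (rule sum.image_gen[OF fin])
  also have "\<dots> = (\<Sum>s\<in>\<sigma> ` B. real (card (C s)) * s)"
  proof (rule sum.cong[OF refl])
    fix s assume "s \<in> \<sigma> ` B"
    then show "(\<Sum>b\<in>{b \<in> B. \<sigma> b = s}. \<sigma> b) = real (card (C s)) * s"
      by (subst fib[symmetric]) simp_all
  qed
  also have "\<dots> = nuclear_norm X"
    by (simp add: nuclear_norm_def img C(4))
  finally show thesis
    using that[of B \<sigma>, OF fin orth nB sp \<sigma>0] C(1) B_iff by auto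
qed

section \<open>Dual norms\<close>

lemma nuclear_norm_nonneg: "0 \<le> nuclear_norm L"
  by (auto simp: nuclear_norm_def singular_values_def intro!: sum_nonneg)

lemma entry_l1_norm_nonneg: "0 \<le> entry_l1_norm S"
  by (auto simp: entry_l1_norm_def intro!: sum_nonneg)

lemma mat_inner_eq_inner: "mat_inner X Y = X \<bullet> Y"
proof -
  have "mat_inner X Y = (\<Sum>k\<in>UNIV. \<Sum>j\<in>UNIV. X $ j $ k * Y $ j $ k)"
    by (simp add: mat_inner_def trace_def matrix_matrix_mult_def transpose_def)
  also have "\<dots> = (\<Sum>j\<in>UNIV. \<Sum>k\<in>UNIV. X $ j $ k * Y $ j $ k)"
    by (rule sum.swap)
  finally show ?thesis by (simp add: inner_vec_def)
qed

lemma orthonormal_parseval: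
  fixes x y :: "'a::euclidean_space"
  assumes "finite B" "pairwise orthogonal B" "\<And>b. b \<in> B \<Longrightarrow> norm b = 1" "span B = UNIV"
  shows "(\<Sum>b\<in>B. (b \<bullet> x) * (b \<bullet> y)) = x \<bullet> y"
proof -
  have "x \<bullet> y = (\<Sum>b\<in>B. (b \<bullet> x) *\<^sub>R b) \<bullet> y"
    using orthonormal_basis_expand[of B x] assms by (simp add: inner_commute)
  then show ?thesis by (simp add: inner_sum_left)
qed

text \<open>The trace may be computed in any orthonormal basis: this is Parseval's identity, row by row.\<close>

lemma mat_inner_orthonormal_basis:
  fixes X Y :: "real^'n2^'n1"
  assumes "finite B" "pairwise orthogonal B" "\<And>b. b \<in> B \<Longrightarrow> norm b = 1" "span B = UNIV"
  shows "mat_inner X Y = (\<Sum>b\<in>B. (X *v b) \<bullet> (Y *v b))"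
proof -
  have "(\<Sum>b\<in>B. (X *v b) \<bullet> (Y *v b)) = (\<Sum>b\<in>B. \<Sum>j\<in>UNIV. (b \<bullet> X $ j) * (b \<bullet> Y $ j))"
    by (simp add: inner_vec_def[of "_ *v _"] matrix_vector_mul_component inner_commute)
  also have "\<dots> = (\<Sum>j\<in>UNIV. \<Sum>b\<in>B. (b \<bullet> X $ j) * (b \<bullet> Y $ j))"
    by (rule sum.swap)
  also have "\<dots> = (\<Sum>j\<in>UNIV. X $ j \<bullet> Y $ j)"
    using orthonormal_parseval[OF assms] by simp
  finally show ?thesis by (simp add: mat_inner_eq_inner inner_vec_def)
qed

lemma spectral_norm_bound: "norm (X *v v) \<le> spectral_norm X * norm v"
  unfolding spectral_norm_def by (rule onorm) (rule matrix_vector_mul_bounded_linear)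

lemma spectral_nuclear_holder:
  fixes X L :: "real^'n2^'n1"
  shows "\<bar>mat_inner X L\<bar> \<le> spectral_norm X * nuclear_norm L"
proof -
  obtain B \<sigma> where B: "finite B" "pairwise orthogonal B" "\<And>b. b \<in> B \<Longrightarrow> norm b = 1"
    "span B = UNIV" "\<And>b. b \<in> B \<Longrightarrow> 0 \<le> \<sigma> b" "\<And>b. b \<in> B \<Longrightarrow> b \<in> singular_space L (\<sigma> b)"
    "nuclear_norm L = (\<Sum>b\<in>B. \<sigma> b)"
    using singular_basis_exists[of L] by blast
  have "\<bar>(X *v b) \<bullet> (L *v b)\<bar> \<le> spectral_norm X * \<sigma> b" if b: "b \<in> B" for b
  proof -
    have "(norm (L *v b))\<^sup>2 = (\<sigma> b)\<^sup>2"
      using singular_space_inner[OF B(6)[OF b], of b] B(3)[OF b] by (simp add: dot_square_norm)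
    then have "norm (L *v b) = \<sigma> b" using B(5)[OF b] by simp
    moreover have "norm (X *v b) \<le> spectral_norm X"
      using spectral_norm_bound[of X b] B(3)[OF b] by simp
    ultimately show ?thesis
      using Cauchy_Schwarz_ineq2[of "X *v b" "L *v b"] B(5)[OF b]
      by (metis mult_right_mono order_trans)
  qed
  then have "(\<Sum>b\<in>B. \<bar>(X *v b) \<bullet> (L *v b)\<bar>) \<le> (\<Sum>b\<in>B. spectral_norm X * \<sigma> b)"
    by (rule sum_mono)
  then have "\<bar>\<Sum>b\<in>B. (X *v b) \<bullet> (L *v b)\<bar> \<le> (\<Sum>b\<in>B. spectral_norm X * \<sigma> b)"
    by (rule order_trans[OF sum_abs])
  then show ?thesis
    by (simp add: mat_inner_orthonormal_basis[OF B(1,2,3,4)] B(7) sum_distrib_left)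
qed

text \<open>
  The witness is the partial isometry of the polar decomposition of \<open>L\<close>. It sends each right
  singular vector \<open>b\<close> to the unit vector \<open>L b / \<sigma> b\<close>, or to \<open>0\<close> if \<open>\<sigma> b = 0\<close>; these images are
  pairwise orthogonal, so it does not increase lengths.
\<close>

lemma nuclear_norm_attained:
  fixes L :: "real^'n2^'n1"
  obtains U :: "real^'n2^'n1" where "\<And>v. norm (U *v v) \<le> norm v" "mat_inner U L = nuclear_norm L"
proof -
  obtain B \<sigma> where B: "finite B" "pairwise orthogonal B" "\<And>b. b \<in> B \<Longrightarrow> norm b = 1"
    "span B = UNIV" "\<And>b. b \<in> B \<Longrightarrow> 0 \<le> \<sigma> b" "\<And>b. b \<in> B \<Longrightarrow> b \<in> singular_space L (\<sigma> b)"
    "nuclear_norm L = (\<Sum>b\<in>B. \<sigma> b)"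
    using singular_basis_exists[of L] by blast
  \<comment> \<open>\<open>x / 0 = 0\<close> makes the basis vectors in the kernel of \<open>L\<close> drop out\<close>
  define f where "f v = (\<Sum>b\<in>B. ((b \<bullet> v) / \<sigma> b) *\<^sub>R (L *v b))" for v
  have "linear f"
    unfolding f_def
    by (intro linearI) (simp_all add: inner_add_right add_divide_distrib scaleR_add_left
        sum.distrib scaleR_sum_right)
  then have U: "matrix f *v v = f v" for v
    by (simp add: linear_matrix_vector_mul_eq)
  have Lb: "(L *v b) \<bullet> (L *v c) = (\<sigma> b)\<^sup>2 * (b \<bullet> c)" if "b \<in> B" for b c
    using singular_space_inner[OF B(6)[OF that]] .
  have ortho: "b \<bullet> c = (if b = c then 1 else 0)" if "b \<in> B" "c \<in> B" for b c
    using that B(2,3) by (auto simp: pairwise_def orthogonal_def dot_square_norm)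
  have nL: "norm (L *v b) = \<sigma> b" if "b \<in> B" for b
    using Lb[OF that, of b] that B(5) ortho[OF that that] by (simp add: dot_square_norm)
  have "norm (f v) \<le> norm v" for v
  proof -
    have "(norm (f v))\<^sup>2 = (\<Sum>b\<in>B. (norm (((b \<bullet> v) / \<sigma> b) *\<^sub>R (L *v b)))\<^sup>2)"
      unfolding f_def using B(1)
      by (rule norm_sum_Pythagorean)
        (auto simp: pairwise_def orthogonal_def Lb ortho)
    also have "\<dots> \<le> (\<Sum>b\<in>B. (b \<bullet> v) * (b \<bullet> v))"
      by (rule sum_mono) (auto simp: nL power2_eq_square)
    also have "\<dots> = (norm v)\<^sup>2"
      using orthonormal_parseval[OF B(1,2,3,4)] by (simp add: dot_square_norm)
    finally show ?thesis by simp
  qed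
  moreover have "mat_inner (matrix f) L = nuclear_norm L"
  proof -
    have "f b \<bullet> (L *v b) = \<sigma> b" if b: "b \<in> B" for b
    proof -
      have "f b = (\<Sum>c\<in>B. if c = b then (1 / \<sigma> b) *\<^sub>R (L *v b) else 0)"
        unfolding f_def by (rule sum.cong) (auto simp: ortho b)
      then have "f b = (1 / \<sigma> b) *\<^sub>R (L *v b)" using B(1) b by simp
      then show ?thesis using Lb[OF b, of b] ortho[OF b b] by (simp add: power2_eq_square)
    qed
    then show ?thesis
      by (simp add: mat_inner_orthonormal_basis[OF B(1,2,3,4)] U B(7))
  qed
  ultimately show thesis
    using that[of "matrix f"] U by simp
qed

lemma entry_max_norm_ge: "\<bar>Z $ j $ k\<bar> \<le> entry_max_norm Z"
  unfolding entry_max_norm_def by (rule Max_ge) (auto intro: image_eqI[of _ _ "(j, k)"])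

lemma entry_max_l1_holder:
  fixes Z S :: "real^'n2^'n1"
  shows "\<bar>mat_inner Z S\<bar> \<le> entry_max_norm Z * entry_l1_norm S"
proof -
  have "\<bar>Z $ j $ k * S $ j $ k\<bar> \<le> entry_max_norm Z * \<bar>S $ j $ k\<bar>" for j k
    by (simp add: abs_mult mult_right_mono entry_max_norm_ge)
  then show ?thesis
    unfolding mat_inner_eq_inner entry_l1_norm_def inner_vec_def sum_distrib_left
    by (auto intro!: order_trans[OF sum_abs] sum_mono)
qed

lemma entry_l1_norm_attained:
  "mat_inner (\<chi> j k. sgn (S $ j $ k)) S = entry_l1_norm S"
  by (simp add: mat_inner_eq_inner inner_vec_def entry_l1_norm_def abs_sgn mult.commute)

section \<open>The inner supremum\<close>

text \<open>
  Minkowski's inequality in \<open>L\<^sup>2\<close>, for a deterministic \<open>r\<close>. Integrate the weighted inequality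
  \<open>(x + y)\<^sup>2 \<le> (1 + \<beta> / \<alpha>) x\<^sup>2 + (1 + \<alpha> / \<beta>) y\<^sup>2\<close>; with \<open>\<alpha>\<close> and \<open>\<beta>\<close> the two norms its right-hand side
  becomes exactly \<open>(\<alpha> + \<beta>)\<^sup>2\<close>. To have nonzero weights, both bounds are enlarged by \<open>e > 0\<close>, and \<open>e\<close>
  tends to \<open>0\<close> at the end.
\<close>

lemma sum_nn_integral_square_add_le:
  fixes r :: "'i \<Rightarrow> real" and t :: "'i \<Rightarrow> 'w \<Rightarrow> real"
  assumes M: "prob_space M" and I: "finite I"
    and meas: "\<And>p. p \<in> I \<Longrightarrow> t p \<in> borel_measurable M"
    and ab: "0 \<le> a" "0 \<le> b"
    and r: "(\<Sum>p\<in>I. (r p)\<^sup>2) \<le> a\<^sup>2"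
    and t: "(\<Sum>p\<in>I. \<integral>\<^sup>+ \<omega>. ennreal ((t p \<omega>)\<^sup>2) \<partial>M) \<le> ennreal (b\<^sup>2)"
  shows "(\<Sum>p\<in>I. \<integral>\<^sup>+ \<omega>. ennreal ((r p + t p \<omega>)\<^sup>2) \<partial>M) \<le> ennreal ((a + b)\<^sup>2)"
    (is "?I \<le> _")
proof -
  interpret prob_space M by fact
  have pos: "?I \<le> ennreal ((a + e + (b + e))\<^sup>2)" if e: "e > 0" for e
  proof -
    define \<alpha> \<beta> where "\<alpha> = a + e" and "\<beta> = b + e"
    have \<alpha>\<beta>: "\<alpha> > 0" "\<beta> > 0" using ab e by (auto simp: \<alpha>_def \<beta>_def)
    have pt: "(x + y)\<^sup>2 \<le> (1 + \<beta> / \<alpha>) * x\<^sup>2 + (1 + \<alpha> / \<beta>) * y\<^sup>2" for x y :: real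
    proof -
      have "0 \<le> (\<alpha> / \<beta>) * (y - (\<beta> / \<alpha>) * x)\<^sup>2" using \<alpha>\<beta> by simp
      also have "\<dots> = (1 + \<beta> / \<alpha>) * x\<^sup>2 + (1 + \<alpha> / \<beta>) * y\<^sup>2 - (x + y)\<^sup>2"
        using \<alpha>\<beta> by (simp add: field_simps power2_eq_square)
      finally show ?thesis by simp
    qed
    have "?I \<le> (\<Sum>p\<in>I. ennreal ((1 + \<beta> / \<alpha>) * (r p)\<^sup>2)
        + ennreal (1 + \<alpha> / \<beta>) * (\<integral>\<^sup>+ \<omega>. ennreal ((t p \<omega>)\<^sup>2) \<partial>M))"
    proof (rule sum_mono)
      fix p assume p: "p \<in> I"
      note [measurable] = meas[OF p]
      have "(\<integral>\<^sup>+ \<omega>. ennreal ((r p + t p \<omega>)\<^sup>2) \<partial>M)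
          \<le> (\<integral>\<^sup>+ \<omega>. ennreal ((1 + \<beta> / \<alpha>) * (r p)\<^sup>2) + ennreal (1 + \<alpha> / \<beta>) * ennreal ((t p \<omega>)\<^sup>2) \<partial>M)"
        using \<alpha>\<beta> pt by (intro nn_integral_mono) (simp add: ennreal_plus[symmetric] ennreal_mult[symmetric] del: ennreal_plus)
      also have "\<dots> = ennreal ((1 + \<beta> / \<alpha>) * (r p)\<^sup>2)
          + ennreal (1 + \<alpha> / \<beta>) * (\<integral>\<^sup>+ \<omega>. ennreal ((t p \<omega>)\<^sup>2) \<partial>M)"
        by (simp add: nn_integral_add nn_integral_cmult emeasure_space_1)
      finally show "(\<integral>\<^sup>+ \<omega>. ennreal ((r p + t p \<omega>)\<^sup>2) \<partial>M) \<le> \<dots>" .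
    qed
    also have "\<dots> = ennreal ((1 + \<beta> / \<alpha>) * (\<Sum>p\<in>I. (r p)\<^sup>2))
        + ennreal (1 + \<alpha> / \<beta>) * (\<Sum>p\<in>I. \<integral>\<^sup>+ \<omega>. ennreal ((t p \<omega>)\<^sup>2) \<partial>M)"
      using \<alpha>\<beta> by (simp add: sum.distrib sum_distrib_left sum_ennreal)
    also have "\<dots> \<le> ennreal ((1 + \<beta> / \<alpha>) * \<alpha>\<^sup>2) + ennreal (1 + \<alpha> / \<beta>) * ennreal (\<beta>\<^sup>2)"
    proof (intro add_mono mult_left_mono ennreal_leI order_trans[OF r] order_trans[OF t])
      show "a\<^sup>2 \<le> \<alpha>\<^sup>2" "b\<^sup>2 \<le> \<beta>\<^sup>2" using ab e by (auto simp: \<alpha>_def \<beta>_def intro!: power_mono)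
    qed (use \<alpha>\<beta> in auto)
    also have "\<dots> = ennreal ((1 + \<beta> / \<alpha>) * \<alpha>\<^sup>2 + (1 + \<alpha> / \<beta>) * \<beta>\<^sup>2)"
      using \<alpha>\<beta> by (simp add: ennreal_mult ennreal_plus)
    also have "(1 + \<beta> / \<alpha>) * \<alpha>\<^sup>2 + (1 + \<alpha> / \<beta>) * \<beta>\<^sup>2 = (\<alpha> + \<beta>)\<^sup>2"
      using \<alpha>\<beta> by (simp add: field_simps power2_eq_square)
    finally show ?thesis by (simp add: \<alpha>_def \<beta>_def)
  qed
  have "((\<lambda>e. ennreal ((a + e + (b + e))\<^sup>2)) \<longlongrightarrow> ennreal ((a + 0 + (b + 0))\<^sup>2)) (at_right 0)"
    by (intro tendsto_intros)
  moreover have "\<forall>\<^sub>F e in at_right 0. ?I \<le> ennreal ((a + e + (b + e))\<^sup>2)"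
    using eventually_at_right_less by (rule eventually_mono) (rule pos)
  ultimately have "?I \<le> ennreal ((a + 0 + (b + 0))\<^sup>2)"
    by (rule tendsto_lowerbound) simp
  then show ?thesis by simp
qed

text \<open>
  One budget \<open>q\<close> controls both perturbations, \<open>\<parallel>X\<parallel> \<le> q\<close> and \<open>\<parallel>Z\<parallel>\<^sub>\<infinity> \<le> lam q\<close>. This is where the
  maximum in the constraint becomes the sum of two norms in the objective.
\<close>

lemma perturbation_bound:
  fixes X Z L S :: "real^'n2^'n1"
  assumes "lam > 0"
  shows "(mat_inner X L + mat_inner Z S)\<^sup>2 \<le> (nuclear_norm L + lam * entry_l1_norm S)\<^sup>2
      * max ((spectral_norm X)\<^sup>2) ((entry_max_norm Z)\<^sup>2 / lam\<^sup>2)"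
proof -
  define q where "q = sqrt (max ((spectral_norm X)\<^sup>2) ((entry_max_norm Z)\<^sup>2 / lam\<^sup>2))"
  have q2: "q\<^sup>2 = max ((spectral_norm X)\<^sup>2) ((entry_max_norm Z)\<^sup>2 / lam\<^sup>2)"
    by (simp add: q_def le_max_iff_disj)
  have "spectral_norm X \<le> q"
    unfolding q_def by (rule real_le_rsqrt) simp
  moreover have "entry_max_norm Z / lam \<le> q"
    unfolding q_def by (rule real_le_rsqrt) (simp add: power_divide)
  then have "entry_max_norm Z \<le> lam * q"
    using assms by (simp add: field_simps)
  ultimately have "\<bar>mat_inner X L\<bar> \<le> q * nuclear_norm L"
      "\<bar>mat_inner Z S\<bar> \<le> lam * q * entry_l1_norm S"
    using spectral_nuclear_holder[of X L] entry_max_l1_holder[of Z S]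
      nuclear_norm_nonneg[of L] entry_l1_norm_nonneg[of S]
    by (meson mult_right_mono order_trans)+
  then have "\<bar>mat_inner X L + mat_inner Z S\<bar> \<le> (nuclear_norm L + lam * entry_l1_norm S) * q"
    by (simp add: algebra_simps)
  then show ?thesis
    by (metis abs_ge_zero power2_abs power_mono power_mult_distrib q2)
qed

text \<open>The residual with the sign, and over the index pairs, as it occurs in the robust problem.\<close>

lemma P_objective_residual:
  "P_objective D \<Omega> lam \<mu> L S = nuclear_norm L + lam * entry_l1_norm S
     + \<mu> * sqrt (\<Sum>p\<in>\<Omega>. ((D - L - S) $ fst p $ snd p)\<^sup>2)"
proof -
  have "(\<Sum>(j, k)\<in>\<Omega>. (L $ j $ k + S $ j $ k - D $ j $ k)\<^sup>2)
      = (\<Sum>p\<in>\<Omega>. ((D - L - S) $ fst p $ snd p)\<^sup>2)"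
    by (rule sum.cong) (auto simp: power2_eq_square algebra_simps)
  then show ?thesis by (simp add: P_objective_def)
qed

lemma worst_case_le:
  fixes D L S :: "real^'n2^'n1"
  assumes lam: "lam > 0" and mu: "\<mu> > 0"
    and feas: "(M, \<xi>, \<zeta>) \<in> R_feasible \<Omega> lam \<mu>"
  shows "R_objective D \<Omega> L S M \<xi> \<zeta>
      \<le> ennreal (1 / (\<mu>\<^sup>2 * real (card \<Omega>)) * (P_objective D \<Omega> lam \<mu> L S)\<^sup>2)"
proof -
  let ?A = "nuclear_norm L + lam * entry_l1_norm S"
  define \<rho> where "\<rho> = sqrt (\<Sum>p\<in>\<Omega>. ((D - L - S) $ fst p $ snd p)\<^sup>2)"
  define t where "t p \<omega> = mat_inner (\<xi> p \<omega>) L + mat_inner (\<zeta> p \<omega>) S" for p \<omega>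
  have A0: "0 \<le> ?A"
    using lam nuclear_norm_nonneg[of L] entry_l1_norm_nonneg[of S] by simp
  have M: "prob_space M"
    and [measurable]: "\<And>p. p \<in> \<Omega> \<Longrightarrow> \<xi> p \<in> borel_measurable M" "\<And>p. p \<in> \<Omega> \<Longrightarrow> \<zeta> p \<in> borel_measurable M"
    and budget: "(\<Sum>p\<in>\<Omega>. \<integral>\<^sup>+ \<omega>. ennreal (max ((spectral_norm (\<xi> p \<omega>))\<^sup>2)
        ((entry_max_norm (\<zeta> p \<omega>))\<^sup>2 / lam\<^sup>2)) \<partial>M) \<le> ennreal (1 / \<mu>\<^sup>2)"
    using feas by (auto simp: R_feasible_def)
  have tm: "t p \<in> borel_measurable M" if "p \<in> \<Omega>" for p
    using that unfolding t_def mat_inner_eq_inner by measurable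
  have "(\<Sum>p\<in>\<Omega>. \<integral>\<^sup>+ \<omega>. ennreal ((t p \<omega>)\<^sup>2) \<partial>M) \<le> ennreal ((?A / \<mu>)\<^sup>2)"
  proof (cases "?A = 0")
    case True
    have "t p \<omega> = 0" for p \<omega>
      using perturbation_bound[OF lam, of "\<xi> p \<omega>" L "\<zeta> p \<omega>" S] True by (simp add: t_def)
    then show ?thesis by simp
  next
    case False
    with A0 have A: "?A > 0" by simp
    \<comment> \<open>the factor \<open>A\<^sup>2\<close> is taken out of an integral of \<open>t\<close>, which is measurable as a linear
      function of the matrices; the costs enter by monotonicity of the integral only\<close>
    have "(\<Sum>p\<in>\<Omega>. \<integral>\<^sup>+ \<omega>. ennreal ((t p \<omega>)\<^sup>2) \<partial>M)
        = ennreal (?A\<^sup>2) * (\<Sum>p\<in>\<Omega>. \<integral>\<^sup>+ \<omega>. ennreal ((t p \<omega>)\<^sup>2 / ?A\<^sup>2) \<partial>M)"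
      unfolding sum_distrib_left
    proof (rule sum.cong[OF refl])
      fix p assume "p \<in> \<Omega>"
      note [measurable] = tm[OF this]
      have "(\<integral>\<^sup>+ \<omega>. ennreal ((t p \<omega>)\<^sup>2) \<partial>M)
          = (\<integral>\<^sup>+ \<omega>. ennreal (?A\<^sup>2) * ennreal ((t p \<omega>)\<^sup>2 / ?A\<^sup>2) \<partial>M)"
        using A by (simp add: ennreal_mult[symmetric])
      also have "\<dots> = ennreal (?A\<^sup>2) * (\<integral>\<^sup>+ \<omega>. ennreal ((t p \<omega>)\<^sup>2 / ?A\<^sup>2) \<partial>M)"
        by (rule nn_integral_cmult) measurable
      finally show "(\<integral>\<^sup>+ \<omega>. ennreal ((t p \<omega>)\<^sup>2) \<partial>M) = \<dots>" .
    qed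
    also have "\<dots> \<le> ennreal (?A\<^sup>2) * ennreal (1 / \<mu>\<^sup>2)"
    proof (rule mult_left_mono[OF order_trans[OF _ budget]])
      show "(\<Sum>p\<in>\<Omega>. \<integral>\<^sup>+ \<omega>. ennreal ((t p \<omega>)\<^sup>2 / ?A\<^sup>2) \<partial>M)
          \<le> (\<Sum>p\<in>\<Omega>. \<integral>\<^sup>+ \<omega>. ennreal (max ((spectral_norm (\<xi> p \<omega>))\<^sup>2)
              ((entry_max_norm (\<zeta> p \<omega>))\<^sup>2 / lam\<^sup>2)) \<partial>M)"
        using A perturbation_bound[OF lam]
        by (intro sum_mono nn_integral_mono ennreal_leI)
          (simp add: t_def pos_divide_le_eq mult.commute)
    qed simp
    also have "\<dots> = ennreal ((?A / \<mu>)\<^sup>2)"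
      by (simp add: ennreal_mult[symmetric] power_divide)
    finally show ?thesis .
  qed
  then have "(\<Sum>p\<in>\<Omega>. \<integral>\<^sup>+ \<omega>. ennreal (((D - L - S) $ fst p $ snd p + t p \<omega>)\<^sup>2) \<partial>M)
      \<le> ennreal ((\<rho> + ?A / \<mu>)\<^sup>2)"
    using A0 mu tm M
    by (intro sum_nn_integral_square_add_le) (auto simp: \<rho>_def sum_nonneg)
  then have "R_objective D \<Omega> L S M \<xi> \<zeta> \<le> ennreal (1 / real (card \<Omega>)) * ennreal ((\<rho> + ?A / \<mu>)\<^sup>2)"
    unfolding R_objective_def by (intro mult_left_mono) (simp_all add: case_prod_beta t_def add.assoc)
  also have "\<dots> = ennreal (1 / real (card \<Omega>) * (\<rho> + ?A / \<mu>)\<^sup>2)"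
    by (rule ennreal_mult[symmetric]) simp_all
  also have "1 / real (card \<Omega>) * (\<rho> + ?A / \<mu>)\<^sup>2
      = 1 / (\<mu>\<^sup>2 * real (card \<Omega>)) * (P_objective D \<Omega> lam \<mu> L S)\<^sup>2"
  proof -
    have "P_objective D \<Omega> lam \<mu> L S = \<mu> * (\<rho> + ?A / \<mu>)"
      using mu by (simp add: P_objective_residual \<rho>_def field_simps)
    then show ?thesis
      using mu by (simp add: power_mult_distrib)
  qed
  finally show ?thesis .
qed

text \<open>
  Equality in Cauchy-Schwarz: \<open>c\<close> of prescribed length, parallel to \<open>r\<close>. If \<open>r = 0\<close>, every
  direction is parallel to it, and a constant vector is taken.
\<close>

lemma aligned_weights_exist:
  fixes r :: "'i \<Rightarrow> real"
  assumes "finite I" "I \<noteq> {}" "0 \<le> b"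
  obtains c where "(\<Sum>p\<in>I. (c p)\<^sup>2) = b\<^sup>2" "(\<Sum>p\<in>I. r p * c p) = b * sqrt (\<Sum>p\<in>I. (r p)\<^sup>2)"
proof (cases "(\<Sum>p\<in>I. (r p)\<^sup>2) = 0")
  case True
  then have "r p = 0" if "p \<in> I" for p
    using that assms by (simp add: sum_nonneg_eq_0_iff)
  moreover have "(\<Sum>p\<in>I. (b / sqrt (real (card I)))\<^sup>2) = b\<^sup>2"
    using assms by (simp add: power_divide)
  ultimately show thesis
    using True by (intro that[of "\<lambda>_. b / sqrt (real (card I))"]) simp_all
next
  case False
  define \<rho> where "\<rho> = sqrt (\<Sum>p\<in>I. (r p)\<^sup>2)"
  have \<rho>: "\<rho> \<noteq> 0" "(\<Sum>p\<in>I. (r p)\<^sup>2) = \<rho>\<^sup>2"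
    using False by (simp_all add: \<rho>_def sum_nonneg)
  have "(\<Sum>p\<in>I. (b * r p / \<rho>)\<^sup>2) = (b / \<rho>)\<^sup>2 * (\<Sum>p\<in>I. (r p)\<^sup>2)"
    by (simp add: sum_distrib_left power_divide power_mult_distrib)
  moreover have "(\<Sum>p\<in>I. r p * (b * r p / \<rho>)) = (b / \<rho>) * (\<Sum>p\<in>I. (r p)\<^sup>2)"
    by (simp add: sum_distrib_left power2_eq_square mult.commute mult.left_commute)
  ultimately show thesis
    using \<rho>(1) unfolding \<rho>(2)
    by (intro that[of "\<lambda>p. b * r p / \<rho>"], unfold \<rho>_def[symmetric])
      (simp_all add: power_divide power2_eq_square)
qed

lemma worst_case_attained:
  fixes D L S :: "real^'n2^'n1"
  assumes lam: "lam > 0" and mu: "\<mu> > 0" and \<Omega>: "\<Omega> \<noteq> {}"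
  obtains M :: "'w measure" and \<xi> \<zeta> where "(M, \<xi>, \<zeta>) \<in> R_feasible \<Omega> lam \<mu>"
    "R_objective D \<Omega> L S M \<xi> \<zeta>
      = ennreal (1 / (\<mu>\<^sup>2 * real (card \<Omega>)) * (P_objective D \<Omega> lam \<mu> L S)\<^sup>2)"
proof -
  let ?A = "nuclear_norm L + lam * entry_l1_norm S"
  let ?r = "\<lambda>p. (D - L - S) $ fst p $ snd p"
  let ?\<rho> = "sqrt (\<Sum>p\<in>\<Omega>. (?r p)\<^sup>2)"
  obtain U :: "real^'n2^'n1" where U: "\<And>v. norm (U *v v) \<le> norm v" "mat_inner U L = nuclear_norm L"
    using nuclear_norm_attained[of L] by blast
  define G :: "real^'n2^'n1" where "G = (\<chi> j k. sgn (S $ j $ k))"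
  obtain c where c: "(\<Sum>p\<in>\<Omega>. (c p)\<^sup>2) = (1 / \<mu>)\<^sup>2" "(\<Sum>p\<in>\<Omega>. ?r p * c p) = (1 / \<mu>) * ?\<rho>"
    using aligned_weights_exist[of \<Omega> "1 / \<mu>" ?r] \<Omega> mu by auto
  \<comment> \<open>constant families live on every outcome type, so a point mass anywhere serves\<close>
  define M :: "'w measure" where "M = return (count_space UNIV) undefined"
  define \<xi> :: "'n1 \<times> 'n2 \<Rightarrow> 'w \<Rightarrow> real^'n2^'n1" where "\<xi> p \<omega> = c p *\<^sub>R U" for p \<omega>
  define \<zeta> :: "'n1 \<times> 'n2 \<Rightarrow> 'w \<Rightarrow> real^'n2^'n1" where "\<zeta> p \<omega> = (c p * lam) *\<^sub>R G" for p \<omega>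
  interpret prob_space M
    unfolding M_def by (rule prob_space_return) simp
  have cost: "max ((spectral_norm (\<xi> p \<omega>))\<^sup>2) ((entry_max_norm (\<zeta> p \<omega>))\<^sup>2 / lam\<^sup>2) \<le> (c p)\<^sup>2" for p \<omega>
  proof -
    have "spectral_norm (\<xi> p \<omega>) \<le> \<bar>c p\<bar>"
      unfolding spectral_norm_def \<xi>_def
      by (rule onorm_le) (simp add: scaleR_matrix_vector_assoc[symmetric] U(1) mult_left_mono)
    moreover have "0 \<le> spectral_norm (\<xi> p \<omega>)"
      unfolding spectral_norm_def by (rule onorm_pos_le) (rule matrix_vector_mul_bounded_linear)
    ultimately have "(spectral_norm (\<xi> p \<omega>))\<^sup>2 \<le> (c p)\<^sup>2"
      by (simp add: abs_le_square_iff[symmetric])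
    moreover have "entry_max_norm (\<zeta> p \<omega>) \<le> \<bar>c p\<bar> * lam"
      unfolding entry_max_norm_def
      using lam by (intro Max.boundedI) (auto simp: \<zeta>_def G_def abs_mult sgn_real_def)
    moreover have "0 \<le> entry_max_norm (\<zeta> p \<omega>)"
      using entry_max_norm_ge[of "\<zeta> p \<omega>"] by (meson abs_ge_zero order_trans)
    ultimately show ?thesis
      using lam power_mono[of "entry_max_norm (\<zeta> p \<omega>)" "\<bar>c p\<bar> * lam" 2]
      by (simp add: power_mult_distrib pos_divide_le_eq)
  qed
  have "(\<Sum>p\<in>\<Omega>. \<integral>\<^sup>+ \<omega>. ennreal (max ((spectral_norm (\<xi> p \<omega>))\<^sup>2)
      ((entry_max_norm (\<zeta> p \<omega>))\<^sup>2 / lam\<^sup>2)) \<partial>M) \<le> (\<Sum>p\<in>\<Omega>. \<integral>\<^sup>+ \<omega>. ennreal ((c p)\<^sup>2) \<partial>M)"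
    by (intro sum_mono nn_integral_mono ennreal_leI cost)
  also have "\<dots> = ennreal (1 / \<mu>\<^sup>2)"
    using c(1) by (simp add: emeasure_space_1 sum_ennreal power_divide)
  finally have feas: "(M, \<xi>, \<zeta>) \<in> R_feasible \<Omega> lam \<mu>"
    by (auto simp: R_feasible_def prob_space_axioms \<xi>_def[abs_def] \<zeta>_def[abs_def])
  have val: "mat_inner (\<xi> p \<omega>) L + mat_inner (\<zeta> p \<omega>) S = c p * ?A" for p \<omega>
    using U(2) entry_l1_norm_attained[of S]
    by (simp add: \<xi>_def \<zeta>_def G_def mat_inner_eq_inner algebra_simps)
  have "R_objective D \<Omega> L S M \<xi> \<zeta>
      = ennreal (1 / real (card \<Omega>)) * (\<Sum>p\<in>\<Omega>. ennreal ((?r p + c p * ?A)\<^sup>2))"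
    unfolding R_objective_def case_prod_beta prod.collapse add.assoc val
    by (simp add: emeasure_space_1)
  also have "\<dots> = ennreal (1 / real (card \<Omega>) * (\<Sum>p\<in>\<Omega>. (?r p + c p * ?A)\<^sup>2))"
    by (subst sum_ennreal) (simp_all only: ennreal_mult[symmetric] sum_nonneg
        zero_le_power2 divide_nonneg_nonneg of_nat_0_le_iff zero_le_one)
  also have "(\<Sum>p\<in>\<Omega>. (?r p + c p * ?A)\<^sup>2)
      = (\<Sum>p\<in>\<Omega>. (?r p)\<^sup>2) + 2 * ?A * (\<Sum>p\<in>\<Omega>. ?r p * c p) + ?A\<^sup>2 * (\<Sum>p\<in>\<Omega>. (c p)\<^sup>2)"
    by (simp only: sum_distrib_left sum.distrib[symmetric])
      (simp add: power2_eq_square algebra_simps)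
  also have "\<dots> = ?\<rho>\<^sup>2 + 2 * ?A * ((1 / \<mu>) * ?\<rho>) + ?A\<^sup>2 * (1 / \<mu>)\<^sup>2"
    unfolding c by (simp add: sum_nonneg)
  also have "\<dots> = (P_objective D \<Omega> lam \<mu> L S)\<^sup>2 / \<mu>\<^sup>2"
    unfolding P_objective_residual using mu by (simp add: field_simps power2_eq_square)
  finally show thesis
    using that[OF feas] by (simp add: mult.commute)
qed

lemma worst_case_value:
  fixes D L S :: "real^'n2^'n1"
  assumes "lam > 0" "\<mu> > 0" "\<Omega> \<noteq> {}"
  shows "(SUP (M :: 'w measure, \<xi>, \<zeta>)\<in>R_feasible \<Omega> lam \<mu>. R_objective D \<Omega> L S M \<xi> \<zeta>)
      = ennreal (1 / (\<mu>\<^sup>2 * real (card \<Omega>)) * (P_objective D \<Omega> lam \<mu> L S)\<^sup>2)"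
proof (rule antisym)
  show "(SUP (M :: 'w measure, \<xi>, \<zeta>)\<in>R_feasible \<Omega> lam \<mu>. R_objective D \<Omega> L S M \<xi> \<zeta>)
      \<le> ennreal (1 / (\<mu>\<^sup>2 * real (card \<Omega>)) * (P_objective D \<Omega> lam \<mu> L S)\<^sup>2)"
    using worst_case_le[OF assms(1,2)] by (intro SUP_least) auto
next
  obtain M :: "'w measure" and \<xi> \<zeta> where "(M, \<xi>, \<zeta>) \<in> R_feasible \<Omega> lam \<mu>"
    "R_objective D \<Omega> L S M \<xi> \<zeta>
      = ennreal (1 / (\<mu>\<^sup>2 * real (card \<Omega>)) * (P_objective D \<Omega> lam \<mu> L S)\<^sup>2)"
    using worst_case_attained[OF assms] by blast
  then show "ennreal (1 / (\<mu>\<^sup>2 * real (card \<Omega>)) * (P_objective D \<Omega> lam \<mu> L S)\<^sup>2)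
      \<le> (SUP (M :: 'w measure, \<xi>, \<zeta>)\<in>R_feasible \<Omega> lam \<mu>. R_objective D \<Omega> L S M \<xi> \<zeta>)"
    by (intro SUP_upper2[of "(M, \<xi>, \<zeta>)"]) simp_all
qed

section \<open>The outer infimum\<close>

lemma INF_ennreal_mult_power2:
  fixes f :: "'a \<Rightarrow> real"
  assumes c: "0 \<le> c" and f: "\<And>x. 0 \<le> f x"
  shows "(INF x. ennreal (c * (f x)\<^sup>2)) = ennreal (c * (INF x. f x)\<^sup>2)"
proof -
  let ?g = "\<lambda>y::real. ennreal (c * (max 0 y)\<^sup>2)"
  have "?g (Inf (range f)) = (INF y\<in>range f. ?g y)"
  proof (rule continuous_at_Inf_mono)
    show "mono ?g"
      using c by (intro monoI ennreal_leI mult_left_mono power_mono) auto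
    show "continuous (at_right (Inf (range f))) ?g"
      by (intro continuous_intros)
    show "bdd_below (range f)"
      using f by (intro bdd_belowI[of _ 0]) auto
  qed simp
  moreover have "0 \<le> Inf (range f)"
    using f by (intro cINF_greatest) auto
  ultimately show ?thesis
    using f by (simp add: image_image max_absorb2)
qed

theorem theorem1:
  fixes D :: "real^'n2^'n1"
    and \<Omega> :: "('n1 \<times> 'n2) set"
    and lam \<mu> :: real
  assumes "CARD('n1) \<ge> CARD('n2)"
    and "lam > 0"
    and "\<mu> > 0"
    and "\<Omega> \<noteq> {}"
  shows "R_value TYPE('w) D \<Omega> lam \<mu>
           = ennreal (1 / (\<mu>\<^sup>2 * real (card \<Omega>)) * (P_value D \<Omega> lam \<mu>)\<^sup>2)"
proof -
  have "0 \<le> P_objective D \<Omega> lam \<mu> L S" for L S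
    using assms nuclear_norm_nonneg[of L] entry_l1_norm_nonneg[of S]
    by (simp add: P_objective_residual sum_nonneg)
  then show ?thesis
    unfolding R_value_def P_value_def worst_case_value[OF assms(2-4)]
    using INF_ennreal_mult_power2[of "1 / (\<mu>\<^sup>2 * real (card \<Omega>))" "\<lambda>(L, S). P_objective D \<Omega> lam \<mu> L S"]
    by (simp add: case_prod_beta)
qed

end
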